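(* Let $A \in \mathrm{M}(m \times m, \mathbb{R})$ be arbitrary, and let $\mu_t = \mathbb{E}(R_t)$ for $t\in\{1,\dots,N\}$ and $\beta_t = \mathbb{E}(D_t)$ for $t\in\{0,\dots,N-1\}$ be the expectations of the multi-step residuals and of the local errors. Then $$\mu_1 = \dots = \mu_N = 0 \quad\Longleftrightarrow\quad \beta_0 = \dots = \beta_{N-1} = 0 .$$
   Context: Setting: $f \colon \mathbb{R}^n \to \mathbb{R}^n$ is continuous, and $X \subset \mathbb{R}^n$ is non-empty, compact and forward invariant ($x \in X$ implies $f(x) \in X$). For $\bar{x} \in X$, $x(\cdot,\bar{x}) \colon \mathbb{N}_0 \to X$ denotes the trajectory $x(0,\bar x) = \bar x$, $x(t+1,\bar x) = f(x(t,\bar x))$. The functions $\psi_1,\dots,\psi_m \in L^2(X,\mathbb{R})$ are continuous and linearly independent, and the lift $\Psi \colon X \to \mathbb{R}^m$, $\Psi(x) = (\psi_1(x),\dots,\psi_m(x))^\top$, is assumed injective. Fixed sample points $x_1,\dots,x_L \in X$ with $L \ge m$ and a fixed horizon $N \in \mathbb{N}$ ($N \geq 1$) are given, and the $m \times L$ matrix $G_0 = (\Psi(x_1)\ \cdots\ \Psi(x_L))$ is assumed to have full row rank. $\mathrm{M}(m\times m,\mathbb{R})$ is the space of real $m \times m$ matrices. For $A \in \mathrm{M}(m\times m,\mathbb{R})$, $z(\cdot,\bar x)\colon \mathbb{N}_0 \to \mathbb{R}^m$ is defined by $z(0,\bar x) = \Psi(\bar x)$, $z(t+1,\bar x) = A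 z(t,\bar x)$. Expectations are taken with respect to the empirical probability measure $P_L = \frac1L \sum_{i=1}^L \delta_{x_i}$ on the Borel sets of $X$ ($\delta_{x_i}$ the Dirac measure at $x_i$), i.e. $\mathbb{E}(Y) = \frac1L\sum_{i=1}^L Y(x_i)$. Multi-step residual: $R_t \colon X \to \mathbb{R}^m$, $R_t(\bar x) = \Psi(x(t,\bar x)) - z(t,\bar x)$ for $t \in \{1,\dots,N\}$. Local error: $D_t \colon X \to \mathbb{R}^m$, $D_t(\bar x) = \Psi(x(t+1,\bar x)) - A\Psi(x(t,\bar x))$ for $t \in \{0,\dots,N-1\}$. *)

theory Defs
  imports "HOL-Analysis.Analysis" "HOL-Probability.Giry_Monad"
begin

text \<open>
  The dimensions n and m are the cardinalities of the index types of the state space and of the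
  lifted space; the sample points are indexed by a finite type \<open>'l\<close>, with L = \<open>CARD('l)\<close>.
  Functions on X are total functions of which only the values on X matter.
\<close>

primrec trajectory :: "('a \<Rightarrow> 'a) \<Rightarrow> nat \<Rightarrow> 'a \<Rightarrow> 'a" where
  "trajectory f 0 x = x"
| "trajectory f (Suc t) x = f (trajectory f t x)"

definition lift :: "('m \<Rightarrow> 'a \<Rightarrow> real) \<Rightarrow> 'a \<Rightarrow> real ^ 'm" where
  "lift \<psi> x = (\<chi> i. \<psi> i x)"

primrec lifted_trajectory ::
  "('m \<Rightarrow> 'a \<Rightarrow> real) \<Rightarrow> real ^ 'm ^ 'm \<Rightarrow> nat \<Rightarrow> 'a \<Rightarrow> real ^ 'm" where
  "lifted_trajectory \<psi> A 0 x = lift \<psi> x"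
| "lifted_trajectory \<psi> A (Suc t) x = A *v lifted_trajectory \<psi> A t x"

definition residual ::
  "('a \<Rightarrow> 'a) \<Rightarrow> ('m \<Rightarrow> 'a \<Rightarrow> real) \<Rightarrow> real ^ 'm ^ 'm \<Rightarrow> nat \<Rightarrow> 'a \<Rightarrow> real ^ 'm" where
  "residual f \<psi> A t x = lift \<psi> (trajectory f t x) - lifted_trajectory \<psi> A t x"

definition local_error ::
  "('a \<Rightarrow> 'a) \<Rightarrow> ('m \<Rightarrow> 'a \<Rightarrow> real) \<Rightarrow> real ^ 'm ^ 'm \<Rightarrow> nat \<Rightarrow> 'a \<Rightarrow> real ^ 'm" where
  "local_error f \<psi> A t x = lift \<psi> (trajectory f (t + 1) x) - A *v lift \<psi> (trajectory f t x)"

definition square_integrable_on :: "('a::euclidean_space \<Rightarrow> real) \<Rightarrow> 'a set \<Rightarrow> bool" where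
  "square_integrable_on g X \<longleftrightarrow>
     set_borel_measurable lebesgue X g \<and> set_integrable lebesgue X (\<lambda>x. (g x)\<^sup>2)"

text \<open>
  Independence is that of functions on X. It is implied by independence of the classes modulo
  null sets, so it is the weaker of the two possible hypotheses.
\<close>

definition linearly_independent_on :: "('m::finite \<Rightarrow> 'a \<Rightarrow> real) \<Rightarrow> 'a set \<Rightarrow> bool" where
  "linearly_independent_on \<psi> X \<longleftrightarrow>
     (\<forall>c :: 'm \<Rightarrow> real. (\<forall>x\<in>X. (\<Sum>i\<in>UNIV. c i * \<psi> i x) = 0) \<longrightarrow> (\<forall>i. c i = 0))"

definition data_matrix :: "('m \<Rightarrow> 'a \<Rightarrow> real) \<Rightarrow> ('l \<Rightarrow> 'a) \<Rightarrow> real ^ 'l ^ 'm" where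
  "data_matrix \<psi> xs = (\<chi> i j. lift \<psi> (xs j) $ i)"

text \<open>\<open>return M x\<close> is the Dirac measure at x on the sets of M.\<close>

definition empirical_measure ::
  "'a::topological_space set \<Rightarrow> ('l::finite \<Rightarrow> 'a) \<Rightarrow> 'a measure" where
  "empirical_measure X xs =
     measure_of X (sets (restrict_space borel X))
       (\<lambda>B. ennreal (1 / real CARD('l)) *
            (\<Sum>j\<in>UNIV. emeasure (return (restrict_space borel X) (xs j)) B))"

lemma space_empirical_measure: "space (empirical_measure X xs) = X"
  and sets_empirical_measure: "sets (empirical_measure X xs) = sets (restrict_space borel X)"
proof -
  have sp: "space (restrict_space borel X) = X"
    by (simp add: space_restrict_space)
  have sub: "sets (restrict_space borel X) \<subseteq> Pow X"
    using sets.space_closed[of "restrict_space borel X"] sp by simp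
  show "space (empirical_measure X xs) = X"
    unfolding empirical_measure_def using sub by (rule space_measure_of)
  show "sets (empirical_measure X xs) = sets (restrict_space borel X)"
    unfolding empirical_measure_def
    using sub sets.sigma_sets_eq[of "restrict_space borel X"] sp
    by (simp add: sets_measure_of)
qed

lemma emeasure_empirical_measure:
  fixes xs :: "'l::finite \<Rightarrow> 'a::topological_space"
  assumes "B \<in> sets (restrict_space borel X)"
  shows "emeasure (empirical_measure X xs) B =
    ennreal (1 / real CARD('l)) *
    (\<Sum>j\<in>UNIV. emeasure (return (restrict_space borel X) (xs j)) B)"
proof (rule emeasure_measure_of[OF empirical_measure_def])
  show "sets (restrict_space borel X) \<subseteq> Pow X"
    using sets.space_closed[of "restrict_space borel X"] by (simp add: space_restrict_space)
  show "B \<in> sets (empirical_measure X xs)"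
    using assms by (simp add: sets_empirical_measure)
  show "positive (sets (empirical_measure X xs))
     (\<lambda>B. ennreal (1 / real CARD('l)) *
        (\<Sum>j\<in>UNIV. emeasure (return (restrict_space borel X) (xs j)) B))"
    by (simp add: positive_def)
  show "countably_additive (sets (empirical_measure X xs))
     (\<lambda>B. ennreal (1 / real CARD('l)) *
        (\<Sum>j\<in>UNIV. emeasure (return (restrict_space borel X) (xs j)) B))"
  proof (rule countably_additiveI)
    fix C :: "nat \<Rightarrow> 'a set"
    assume C: "range C \<subseteq> sets (empirical_measure X xs)" "disjoint_family C"
    have *: "(\<Sum>i. emeasure (return (restrict_space borel X) (xs j)) (C i)) =
        emeasure (return (restrict_space borel X) (xs j)) (\<Union>i. C i)" for j
      using C by (intro suminf_emeasure) (auto simp: sets_empirical_measure)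
    have "(\<Sum>i. \<Sum>j\<in>UNIV. emeasure (return (restrict_space borel X) (xs j)) (C i)) =
        (\<Sum>j\<in>UNIV. \<Sum>i. emeasure (return (restrict_space borel X) (xs j)) (C i))"
      by (rule suminf_sum) simp
    then show "(\<Sum>i. ennreal (1 / real CARD('l)) *
          (\<Sum>j\<in>UNIV. emeasure (return (restrict_space borel X) (xs j)) (C i))) =
        ennreal (1 / real CARD('l)) *
          (\<Sum>j\<in>UNIV. emeasure (return (restrict_space borel X) (xs j)) (\<Union>i. C i))"
      by (simp add: *)
  qed
qed

lemma prob_space_empirical_measure:
  fixes xs :: "'l::finite \<Rightarrow> 'a::topological_space"
  assumes "range xs \<subseteq> X"
  shows "prob_space (empirical_measure X xs)"
proof
  have X: "X \<in> sets (restrict_space borel X)"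
    using sets.top[of "restrict_space borel X"] by (simp add: space_restrict_space)
  have "emeasure (return (restrict_space borel X) (xs j)) X = 1" for j
    using assms X by (auto simp: indicator_def)
  then have "emeasure (empirical_measure X xs) X =
      ennreal (1 / real CARD('l)) * ennreal (real CARD('l))"
    using X by (simp add: emeasure_empirical_measure ennreal_of_nat_eq_real_of_nat)
  also have "\<dots> = 1"
    by (simp add: ennreal_mult[symmetric])
  finally show "emeasure (empirical_measure X xs) (space (empirical_measure X xs)) = 1"
    by (simp add: space_empirical_measure)
qed

end

theory Submission
  imports Defs
begin

text \<open>
  The residuals satisfy \<open>R\<^sub>0 = 0\<close> and \<open>R\<^sub>t\<^sub>+\<^sub>1 = D\<^sub>t + A R\<^sub>t\<close>: over one step the old residual is
  propagated by \<open>A\<close> and the new local error is added (\<open>residual_Suc\<close>). Expectation is linear and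
  commutes with \<open>A\<close>, so the means obey the same recursion
  \<open>\<mu>\<^sub>t\<^sub>+\<^sub>1 = \<beta>\<^sub>t + A \<mu>\<^sub>t\<close>, started at the mean \<open>\<mu>\<^sub>0 = 0\<close> of \<open>R\<^sub>0\<close>. If all \<open>\<beta>\<^sub>t\<close> vanish, then by induction so do all \<open>\<mu>\<^sub>t\<close>;
  conversely \<open>\<beta>\<^sub>t = \<mu>\<^sub>t\<^sub>+\<^sub>1 - A \<mu>\<^sub>t\<close> (\<open>affine_recursion_zero_iff\<close>).

  Linearity of the Bochner integral needs integrability. All functions involved are continuous on
  the compact set \<open>X\<close>, by the continuity of \<open>f\<close> and \<open>\<psi>\<close> and the invariance of \<open>X\<close>, hence bounded
  and measurable, which suffices for a probability measure (\<open>integrable_empirical_measure\<close>).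
\<close>

lemma affine_recursion_zero_iff:
  fixes r b :: "nat \<Rightarrow> 'a::ab_group_add"
  assumes "r 0 = 0" and "T 0 = 0" and step: "\<And>t. t < N \<Longrightarrow> r (Suc t) = b t + T (r t)"
  shows "(\<forall>t\<in>{1..N}. r t = 0) \<longleftrightarrow> (\<forall>t<N. b t = 0)"
proof
  assume "\<forall>t\<in>{1..N}. r t = 0"
  then have r: "r t = 0" if "t \<le> N" for t
    using that \<open>r 0 = 0\<close> by (cases t) auto
  show "\<forall>t<N. b t = 0"
  proof (intro allI impI)
    fix t assume "t < N"
    then show "b t = 0"
      using step[of t] r[of t] r[of "Suc t"] \<open>T 0 = 0\<close> by simp
  qed
next
  assume b: "\<forall>t<N. b t = 0"
  have "t \<le> N \<Longrightarrow> r t = 0" for t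
    using \<open>r 0 = 0\<close> \<open>T 0 = 0\<close> step b by (induction t) auto
  then show "\<forall>t\<in>{1..N}. r t = 0"
    by simp
qed

text \<open>
  Adding and subtracting \<open>A \<Psi>(x\<^sub>t)\<close> in \<open>\<Psi>(x\<^sub>t\<^sub>+\<^sub>1) - A z\<^sub>t\<close> separates the error made in the last step
  from the one inherited from the earlier steps.
\<close>

lemma residual_Suc:
  "residual f \<psi> A (Suc t) x = local_error f \<psi> A t x + A *v residual f \<psi> A t x"
  by (simp add: residual_def local_error_def matrix_vector_mult_diff_distrib)

lemma trajectory_in_invariant_set:
  assumes "\<And>x. x \<in> X \<Longrightarrow> f x \<in> X" and "x \<in> X"
  shows "trajectory f t x \<in> X"
  using assms by (induction t) auto

lemma continuous_on_trajectory:
  assumes "continuous_on X f" and "\<And>x. x \<in> X \<Longrightarrow> f x \<in> X"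
  shows "continuous_on X (trajectory f t)"
proof (induction t)
  case (Suc t)
  have "trajectory f t ` X \<subseteq> X"
    using trajectory_in_invariant_set[of X f] assms(2) by blast
  with Suc show ?case
    using continuous_on_compose2[OF assms(1)] by simp
qed simp

lemma continuous_on_lift:
  fixes \<psi> :: "'m::finite \<Rightarrow> 'a::topological_space \<Rightarrow> real"
  assumes "\<And>i. continuous_on X (\<psi> i)"
  shows "continuous_on X (lift \<psi>)"
  unfolding lift_def[abs_def] by (intro continuous_on_vec_lambda assms)

lemma continuous_on_lift_trajectory:
  fixes \<psi> :: "'m::finite \<Rightarrow> 'a::topological_space \<Rightarrow> real"
  assumes "continuous_on X f" and "\<And>x. x \<in> X \<Longrightarrow> f x \<in> X" and "\<And>i. continuous_on X (\<psi> i)"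
  shows "continuous_on X (\<lambda>x. lift \<psi> (trajectory f t x))"
proof (rule continuous_on_compose2[OF continuous_on_lift continuous_on_trajectory])
  show "trajectory f t ` X \<subseteq> X"
    using trajectory_in_invariant_set[of X f] assms(2) by blast
qed (use assms in auto)

lemma continuous_on_matrix_vector_mult:
  fixes A :: "real ^ 'm::finite ^ 'k::finite"
  assumes "continuous_on X g"
  shows "continuous_on X (\<lambda>x. A *v g x)"
  by (rule bounded_linear.continuous_on[OF matrix_vector_mul_bounded_linear assms])

lemma continuous_on_lifted_trajectory:
  fixes \<psi> :: "'m::finite \<Rightarrow> 'a::topological_space \<Rightarrow> real"
  assumes "\<And>i. continuous_on X (\<psi> i)"
  shows "continuous_on X (lifted_trajectory \<psi> A t)"
proof (induction t)
  case 0
  then show ?case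
    using continuous_on_lift[OF assms] by (simp cong: continuous_on_cong)
next
  case (Suc t)
  then show ?case
    by (simp add: continuous_on_matrix_vector_mult)
qed

lemma integrable_empirical_measure:
  fixes g :: "'a::t2_space \<Rightarrow> 'b::{banach, second_countable_topology}"
    and xs :: "'l::finite \<Rightarrow> 'a"
  assumes "compact X" and "range xs \<subseteq> X" and "continuous_on X g"
  shows "integrable (empirical_measure X xs) g"
proof -
  interpret prob_space "empirical_measure X xs"
    using assms(2) by (rule prob_space_empirical_measure)
  have "bounded (g ` X)"
    using compact_continuous_image[OF assms(3,1)] by (rule compact_imp_bounded)
  then obtain B where B: "\<And>x. x \<in> X \<Longrightarrow> norm (g x) \<le> B"
    unfolding bounded_iff by blast
  have "g \<in> borel_measurable (restrict_space borel X)"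
    by (rule borel_measurable_continuous_on_restrict[OF assms(3)])
  then have "g \<in> borel_measurable (empirical_measure X xs)"
    by (simp cong: measurable_cong_sets add: sets_empirical_measure)
  with B show ?thesis
    by (intro integrable_const_bound[where B = B]) (auto simp: space_empirical_measure)
qed

theorem corollary2:
  fixes f :: "real ^ 'n \<Rightarrow> real ^ 'n"
    and X :: "(real ^ 'n) set"
    and \<psi> :: "'m::finite \<Rightarrow> real ^ 'n \<Rightarrow> real"
    and xs :: "'l::finite \<Rightarrow> real ^ 'n"
    and N :: nat
    and A :: "real ^ 'm ^ 'm"
    and \<mu> \<beta> :: "nat \<Rightarrow> real ^ 'm"
  assumes "continuous_on UNIV f"
    and "X \<noteq> {}" and "compact X" and "\<And>x. x \<in> X \<Longrightarrow> f x \<in> X"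
    and "\<And>i. square_integrable_on (\<psi> i) X"
    and "\<And>i. continuous_on X (\<psi> i)"
    and "linearly_independent_on \<psi> X"
    and "inj_on (lift \<psi>) X"
    and "\<And>j. xs j \<in> X" and "CARD('l) \<ge> CARD('m)"
    and "N \<ge> 1"
    and "rank (data_matrix \<psi> xs) = CARD('m)"
    and "\<And>t. t \<in> {1..N} \<Longrightarrow> \<mu> t = integral\<^sup>L (empirical_measure X xs) (residual f \<psi> A t)"
    and "\<And>t. t \<in> {0..N - 1} \<Longrightarrow> \<beta> t = integral\<^sup>L (empirical_measure X xs) (local_error f \<psi> A t)"
  shows "(\<forall>t\<in>{1..N}. \<mu> t = 0) \<longleftrightarrow> (\<forall>t\<in>{0..N - 1}. \<beta> t = 0)"
proof -
  let ?M = "empirical_measure X xs"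
  let ?r = "\<lambda>t. integral\<^sup>L ?M (residual f \<psi> A t)"
  let ?b = "\<lambda>t. integral\<^sup>L ?M (local_error f \<psi> A t)"
  have f: "continuous_on X f"
    using assms(1) by (rule continuous_on_subset) simp
  note lift = continuous_on_lift_trajectory[OF f assms(4,6)]
  have xs: "range xs \<subseteq> X"
    using assms(9) by blast
  have int_r: "integrable ?M (residual f \<psi> A t)" for t
    unfolding residual_def[abs_def]
    by (intro integrable_empirical_measure[OF assms(3) xs] continuous_on_diff lift
        continuous_on_lifted_trajectory assms(6))
  have int_b: "integrable ?M (local_error f \<psi> A t)" for t
    unfolding local_error_def[abs_def]
    by (intro integrable_empirical_measure[OF assms(3) xs] continuous_on_diff lift
        continuous_on_matrix_vector_mult)
  have "?r (Suc t) = ?b t + A *v ?r t" for t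
  proof -
    have "integrable ?M (\<lambda>x. A *v residual f \<psi> A t x)"
      by (rule integrable_bounded_linear[OF matrix_vector_mul_bounded_linear int_r])
    then have "?r (Suc t) = ?b t + (\<integral>x. A *v residual f \<psi> A t x \<partial>?M)"
      unfolding residual_Suc[abs_def] by (rule Bochner_Integration.integral_add[OF int_b])
    also have "(\<integral>x. A *v residual f \<psi> A t x \<partial>?M) = A *v ?r t"
      by (rule integral_bounded_linear[OF matrix_vector_mul_bounded_linear int_r])
    finally show ?thesis .
  qed
  moreover have "?r 0 = 0"
    by (simp add: residual_def[abs_def])
  ultimately have "(\<forall>t\<in>{1..N}. ?r t = 0) \<longleftrightarrow> (\<forall>t<N. ?b t = 0)"
    by (intro affine_recursion_zero_iff[where T = "(*v) A"]) auto
  moreover have "t < N \<longleftrightarrow> t \<in> {0..N - 1}" for t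
    using \<open>N \<ge> 1\<close> by auto
  ultimately show ?thesis
    using assms(13,14) by auto
qed

end
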